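(* Let $\Theta$ be a nonnegative random variable with law $\mu_\Theta$, and let $X_1,\dots,X_n$ be nonnegative random variables that are conditionally independent given $\Theta$, such that for each $i$ the map $(\theta,t)\mapsto\mathbb E[e^{-tX_i}\mid\Theta=\theta]$ is jointly measurable. Let $S=\sum_{j=1}^n X_j$ and $\mathcal L_i^*(t)=\mathbb E[X_ie^{-tS}]$. Then for every $t>0$ and every $i\in\{1,\dots,n\}$, $$\mathcal L_i^*(t)=\int_{[0,\infty)}\Big(\mathbb E[X_ie^{-tX_i}\mid\Theta=\theta]\prod_{j\ne i}\mathbb E[e^{-tX_j}\mid\Theta=\theta]\Big)\,\mu_\Theta(\mathrm d\theta).$$
   Context: Conditional expectations given $\Theta=\theta$ are taken with respect to a regular conditional distribution of $(X_1,\dots,X_n)$ given $\Theta$. For $t>0$, $\mathcal L_i^*(t)=\mathbb E[X_ie^{-tS}]$ is also equal to $-\partial_{t_i}\mathbb E\big[e^{-\sum_j t_jX_j}\big]$ evaluated at $t_1=\dots=t_n=t$. *)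

theory Defs
  imports "HOL-Probability.Probability"
begin

definition rv_algebra :: "'a measure \<Rightarrow> 'b measure \<Rightarrow> ('a \<Rightarrow> 'b) \<Rightarrow> 'a measure" where
  "rv_algebra M N Z = vimage_algebra (space M) Z N"

definition cond_indep_vars ::
  "'a measure \<Rightarrow> 'a measure \<Rightarrow> ('i \<Rightarrow> 'b measure) \<Rightarrow> ('i \<Rightarrow> 'a \<Rightarrow> 'b) \<Rightarrow> 'i set \<Rightarrow> bool" where
  "cond_indep_vars M F N X I \<longleftrightarrow>
     (\<forall>J\<subseteq>I. finite J \<longrightarrow> (\<forall>A\<in>(\<Pi> j\<in>J. sets (N j)).
        AE \<omega> in M.
          real_cond_exp M F (\<lambda>\<omega>. \<Prod>j\<in>J. indicator (A j) (X j \<omega>)) \<omega>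
          = (\<Prod>j\<in>J. real_cond_exp M F (\<lambda>\<omega>. indicator (A j) (X j \<omega>)) \<omega>)))"

text \<open>
  The exceptional null set may depend on the event \<open>A\<close>, and \<open>\<kappa>\<close> is a genuine
  probability kernel at every point. Integration against \<open>\<kappa> z\<close> is the conditional
  expectation of functions of \<open>Y\<close> given \<open>Z = z\<close>.
\<close>

definition regular_cond_distr ::
  "'a measure \<Rightarrow> 'b measure \<Rightarrow> ('a \<Rightarrow> 'b) \<Rightarrow> 'c measure \<Rightarrow> ('a \<Rightarrow> 'c) \<Rightarrow> ('b \<Rightarrow> 'c measure) \<Rightarrow> bool"
where
  "regular_cond_distr M N Z K Y \<kappa> \<longleftrightarrow>
     \<kappa> \<in> N \<rightarrow>\<^sub>M prob_algebra K \<and>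
     (\<forall>A\<in>sets K. AE \<omega> in M.
        measure (\<kappa> (Z \<omega>)) A
        = real_cond_exp M (rv_algebra M N Z) (\<lambda>\<omega>. indicator A (Y \<omega>)) \<omega>)"

end

theory Submission
  imports Defs
begin

section \<open>Product kernels and coordinate maps\<close>

text \<open>Boxes form an intersection-stable generator, and on a box the product measure is a
  finite product of measurable functions of \<open>z\<close>. This makes the product of the
  marginals a kernel that can be used under a bind. The kernels are given for every
  \<open>j\<close>, not only those in \<open>I\<close>, because \<open>product_prob_space\<close>
  demands a probability space at each index.\<close>

lemma measurable_prob_algebra_PiM:
  assumes I: "finite I"
    and \<kappa>: "\<And>j. \<kappa> j \<in> N \<rightarrow>\<^sub>M prob_algebra (L j)"
  shows "(\<lambda>z. \<Pi>\<^sub>M j\<in>I. \<kappa> j z) \<in> N \<rightarrow>\<^sub>M prob_algebra (\<Pi>\<^sub>M j\<in>I. L j)"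
proof (rule measurable_prob_algebra_generated[OF sets_PiM Int_stable_prod_algebra prod_algebra_sets_into_space])
  fix z assume z: "z \<in> space N"
  have \<kappa>z: "prob_space (\<kappa> j z)" "sets (\<kappa> j z) = sets (L j)" for j
    using measurable_space[OF \<kappa> z] by (auto simp: space_prob_algebra)
  show "prob_space (\<Pi>\<^sub>M j\<in>I. \<kappa> j z)"
    by (rule prob_space_PiM) (rule \<kappa>z)
  show "sets (\<Pi>\<^sub>M j\<in>I. \<kappa> j z) = sets (\<Pi>\<^sub>M j\<in>I. L j)"
    by (rule sets_PiM_cong) (simp_all add: \<kappa>z)
next
  fix B assume "B \<in> prod_algebra I L"
  then obtain A where B: "B = (\<Pi>\<^sub>E j\<in>I. A j)" and A: "\<And>j. j \<in> I \<Longrightarrow> A j \<in> sets (L j)"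
    using I by (auto simp: prod_algebra_eq_finite)
  have "emeasure (\<Pi>\<^sub>M j\<in>I. \<kappa> j z) B = (\<Prod>j\<in>I. emeasure (\<kappa> j z) (A j))" if z: "z \<in> space N" for z
  proof -
    have \<kappa>z: "prob_space (\<kappa> j z)" "sets (\<kappa> j z) = sets (L j)" for j
      using measurable_space[OF \<kappa> z] by (auto simp: space_prob_algebra)
    interpret product_prob_space "\<lambda>j. \<kappa> j z" I
      by (rule product_prob_spaceI) (rule \<kappa>z)
    show ?thesis
      unfolding B using I A by (intro emeasure_PiM) (auto simp: \<kappa>z)
  qed
  moreover have "(\<lambda>z. \<Prod>j\<in>I. emeasure (\<kappa> j z) (A j)) \<in> borel_measurable N"
    using A by (intro borel_measurable_prod_ennreal measurable_emeasure_kernel[OF measurable_prob_algebraD[OF \<kappa>]])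
  ultimately show "(\<lambda>z. emeasure (\<Pi>\<^sub>M j\<in>I. \<kappa> j z) B) \<in> borel_measurable N"
    by (simp cong: measurable_cong)
qed

text \<open>Outside \<open>I\<close> the coordinate is constantly \<open>undefined\<close> on the
  product space, hence still measurable. Having this for all \<open>j\<close> lets the marginals of
  \<open>\<kappa>\<close> be defined at every index.\<close>

lemma measurable_component_PiM_borel:
  "(\<lambda>x :: 'i \<Rightarrow> 'b :: topological_space. x j) \<in> (\<Pi>\<^sub>M j\<in>I. borel) \<rightarrow>\<^sub>M borel"
proof (cases "j \<in> I")
  case False
  have "(\<lambda>_ :: 'i \<Rightarrow> 'b. undefined) \<in> (\<Pi>\<^sub>M j\<in>I. borel) \<rightarrow>\<^sub>M (borel :: 'b measure)"
    by simp
  then show ?thesis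
    by (rule measurable_cong[THEN iffD1, rotated]) (use False in \<open>auto simp: space_PiM PiE_def extensional_def\<close>)
qed (rule measurable_component_singleton)

section \<open>The joint law as a mixture of product measures\<close>

lemma subalgebra_rv_algebra:
  assumes "Z \<in> M \<rightarrow>\<^sub>M N"
  shows "subalgebra M (rv_algebra M N Z)"
  using assms sets_image_in_sets[of M "space M" Z N] by (auto simp: subalgebra_def rv_algebra_def)

text \<open>Comparing with the product kernel on boxes, instead of showing that almost every \<open>\<kappa> z\<close> is a
  product measure, involves one null set at a time, so no countable generator of \<open>borel\<close> is needed.\<close>

lemma distr_eq_bind_PiM_marginals:
  fixes X :: "'i \<Rightarrow> 'a \<Rightarrow> 'b :: topological_space"
  assumes M: "prob_space M" and Z: "Z \<in> M \<rightarrow>\<^sub>M N" and I: "finite I"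
    and X: "\<And>j. j \<in> I \<Longrightarrow> X j \<in> borel_measurable M"
    and indep: "cond_indep_vars M (rv_algebra M N Z) (\<lambda>_. borel) X I"
    and rcd: "regular_cond_distr M N Z (\<Pi>\<^sub>M j\<in>I. borel) (\<lambda>\<omega>. \<lambda>j\<in>I. X j \<omega>) \<kappa>"
  shows "distr M (\<Pi>\<^sub>M j\<in>I. borel) (\<lambda>\<omega>. \<lambda>j\<in>I. X j \<omega>)
    = distr M N Z \<bind> (\<lambda>z. \<Pi>\<^sub>M j\<in>I. distr (\<kappa> z) borel (\<lambda>x. x j))"
    (is "?D = ?B")
proof -
  interpret prob_space M by (rule M)
  define F where "F = rv_algebra M N Z"
  interpret F: finite_measure_subalgebra M F
    by standard (simp add: F_def subalgebra_rv_algebra[OF Z])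
  let ?K = "\<Pi>\<^sub>M j\<in>I. (borel :: 'b measure)"
  define \<nu> where "\<nu> z = (\<Pi>\<^sub>M j\<in>I. distr (\<kappa> z) borel (\<lambda>x. x j))" for z
  have \<kappa>: "\<kappa> \<in> N \<rightarrow>\<^sub>M prob_algebra ?K"
    using rcd by (simp add: regular_cond_distr_def)
  have \<kappa>z: "prob_space (\<kappa> z)" "sets (\<kappa> z) = sets ?K" if "z \<in> space N" for z
    using measurable_space[OF \<kappa> that] by (auto simp: space_prob_algebra)
  have marg: "(\<lambda>z. distr (\<kappa> z) borel (\<lambda>x. x j)) \<in> N \<rightarrow>\<^sub>M prob_algebra borel" for j
    by (rule measurable_compose[OF \<kappa> measurable_distr_prob_space[OF measurable_component_PiM_borel]])
  have \<nu>: "\<nu> \<in> N \<rightarrow>\<^sub>M prob_algebra ?K"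
    unfolding \<nu>_def by (rule measurable_prob_algebra_PiM[OF I marg])
  have Y: "(\<lambda>\<omega>. \<lambda>j\<in>I. X j \<omega>) \<in> M \<rightarrow>\<^sub>M ?K"
    by (rule measurable_restrict) (rule X)
  have D: "distr M N Z \<in> space (prob_algebra N)"
    using prob_space_distr[OF Z] by (simp add: space_prob_algebra)
  have "?D = distr M N Z \<bind> \<nu>"
  proof (rule measure_eqI_PiM_finite[OF I])
    show "sets ?D = sets ?K" by simp
    show "sets (distr M N Z \<bind> \<nu>) = sets ?K" by (rule sets_bind'[OF D \<nu>])
    \<comment> \<open>The whole space is the box with all sides \<open>UNIV\<close> and has finite
      mass, so a constant sequence serves as the exhausting sequence of the uniqueness
      theorem.\<close>
    show "range (\<lambda>_::nat. space ?K) \<subseteq> prod_algebra I (\<lambda>_. borel)"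
      using I by (auto simp: prod_algebra_eq_finite space_PiM intro!: exI[of _ "\<lambda>_. UNIV"])
    show "(\<Union>i::nat. space ?K) = space ?K" by simp
    show "emeasure ?D (space ?K) \<noteq> \<infinity>" for i :: nat
      using prob_space.emeasure_space_1[OF prob_space_distr[OF Y]] by simp
  next
    fix A :: "'i \<Rightarrow> 'b set" assume A: "\<And>j. j \<in> I \<Longrightarrow> A j \<in> sets borel"
    \<comment> \<open>\<open>C j\<close> is the cylinder over \<open>A j\<close>: its mass under
      \<open>\<kappa> z\<close> is the mass of \<open>A j\<close> under the \<open>j\<close>-th
      marginal, which ties the joint kernel to events of a single \<open>X j\<close>.\<close>
    define C where "C j = (\<lambda>x. x j) -` A j \<inter> space ?K" for j
    have C: "C j \<in> sets ?K" if "j \<in> I" for j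
      unfolding C_def by (rule measurable_sets[OF measurable_component_PiM_borel A[OF that]])
    have box: "Pi\<^sub>E I A \<in> sets ?K"
      using I A by (rule sets_PiM_I_finite)
    have ind: "(\<lambda>\<omega>. indicator (A j) (X j \<omega>) :: real) \<in> borel_measurable M" if "j \<in> I" for j
      using that X A by (intro measurable_compose[OF X borel_measurable_indicator]) auto
    have int: "integrable M (\<lambda>\<omega>. \<Prod>j\<in>I. indicator (A j) (X j \<omega>) :: real)"
      using ind by (intro integrable_const_bound[of _ 1] AE_I2)
        (auto simp: abs_prod indicator_def intro!: prod_le_1)
    have "AE \<omega> in M. measure (\<kappa> (Z \<omega>)) (C j) = real_cond_exp M F (\<lambda>\<omega>. indicator (A j) (X j \<omega>)) \<omega>"
      if j: "j \<in> I" for j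
    proof -
      \<comment> \<open>Equality holds at every \<open>\<omega>\<close>, since a restricted vector
        always lies in \<open>space ?K\<close>. The defining property of \<open>\<kappa>\<close> on
        \<open>C j\<close> thus speaks of the indicator of \<open>A j\<close> at
        \<open>X j\<close>.\<close>
      have "(\<lambda>\<omega>. indicator (C j) (\<lambda>j\<in>I. X j \<omega>)) = (\<lambda>\<omega>. indicator (A j) (X j \<omega>) :: real)"
        using j by (auto simp: C_def indicator_def space_PiM)
      then show ?thesis
        using rcd C[OF j] by (auto simp: regular_cond_distr_def F_def)
    qed
    then have ae1: "AE \<omega> in M. \<forall>j\<in>I. measure (\<kappa> (Z \<omega>)) (C j)
        = real_cond_exp M F (\<lambda>\<omega>. indicator (A j) (X j \<omega>)) \<omega>"
      using I by (simp add: AE_finite_all)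
    have ae2: "AE \<omega> in M. real_cond_exp M F (\<lambda>\<omega>. \<Prod>j\<in>I. indicator (A j) (X j \<omega>)) \<omega>
        = (\<Prod>j\<in>I. real_cond_exp M F (\<lambda>\<omega>. indicator (A j) (X j \<omega>)) \<omega>)"
      using indep I A unfolding cond_indep_vars_def F_def by blast
    have meas: "(\<lambda>\<omega>. \<Prod>j\<in>I. measure (\<kappa> (Z \<omega>)) (C j)) \<in> borel_measurable M"
      using C by (intro borel_measurable_prod measurable_compose[OF Z]
          measurable_compose[OF \<kappa> measurable_measure_prob_algebra])
    have "emeasure ?D (Pi\<^sub>E I A) = emeasure M ((\<lambda>\<omega>. \<lambda>j\<in>I. X j \<omega>) -` Pi\<^sub>E I A \<inter> space M)"
      by (rule emeasure_distr[OF Y box])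
    also have "\<dots> = (\<integral>\<^sup>+\<omega>. indicator ((\<lambda>\<omega>. \<lambda>j\<in>I. X j \<omega>) -` Pi\<^sub>E I A \<inter> space M) \<omega> \<partial>M)"
      using measurable_sets[OF Y box] by simp
    also have "\<dots> = (\<integral>\<^sup>+\<omega>. ennreal (\<Prod>j\<in>I. indicator (A j) (X j \<omega>)) \<partial>M)"
    proof (rule nn_integral_cong)
      fix \<omega> assume "\<omega> \<in> space M"
      show "indicator ((\<lambda>\<omega>. \<lambda>j\<in>I. X j \<omega>) -` Pi\<^sub>E I A \<inter> space M) \<omega>
          = ennreal (\<Prod>j\<in>I. indicator (A j) (X j \<omega>))"
      proof (cases "\<forall>j\<in>I. X j \<omega> \<in> A j")
        case False
        then have "(\<Prod>j\<in>I. indicator (A j) (X j \<omega>)) = (0 :: real)"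
          using I by (intro prod_zero) (auto intro!: bexI)
        then show ?thesis using False by (auto simp: indicator_def)
      qed (use \<open>\<omega> \<in> space M\<close> in auto)
    qed
    also have "\<dots> = ennreal (\<integral>\<omega>. (\<Prod>j\<in>I. indicator (A j) (X j \<omega>)) \<partial>M)"
      by (rule nn_integral_eq_integral[OF int]) (simp add: prod_nonneg)
    \<comment> \<open>Taking the conditional expectation preserves the integral; afterwards
      conditional independence (\<open>ae2\<close>) factorizes it, and \<open>ae1\<close> turns each
      factor into a cylinder mass.\<close>
    also have "(\<integral>\<omega>. (\<Prod>j\<in>I. indicator (A j) (X j \<omega>)) \<partial>M)
        = (\<integral>\<omega>. real_cond_exp M F (\<lambda>\<omega>. \<Prod>j\<in>I. indicator (A j) (X j \<omega>)) \<omega> \<partial>M)"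
      by (rule F.real_cond_exp_int(2)[OF int, symmetric])
    also have "\<dots> = (\<integral>\<omega>. (\<Prod>j\<in>I. measure (\<kappa> (Z \<omega>)) (C j)) \<partial>M)"
      using ae1 ae2 by (intro integral_cong_AE meas borel_measurable_cond_exp2) auto
    also have "ennreal \<dots> = (\<integral>\<^sup>+\<omega>. ennreal (\<Prod>j\<in>I. measure (\<kappa> (Z \<omega>)) (C j)) \<partial>M)"
    proof (rule nn_integral_eq_integral[symmetric])
      have "measure (\<kappa> (Z \<omega>)) (C j) \<le> 1" if "\<omega> \<in> space M" for \<omega> j
        using prob_space.prob_le_1[OF \<kappa>z(1)[OF measurable_space[OF Z that]]] .
      then show "integrable M (\<lambda>\<omega>. \<Prod>j\<in>I. measure (\<kappa> (Z \<omega>)) (C j))"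
        by (intro integrable_const_bound[of _ 1] AE_I2 meas) (auto simp: abs_prod intro!: prod_le_1)
    qed (simp add: prod_nonneg)
    \<comment> \<open>This identity is pointwise, not merely almost sure: \<open>Z \<omega>\<close>
      lies in \<open>space N\<close>, where \<open>\<kappa>\<close> is a true probability measure
      and the product of its marginals evaluates boxes by multiplication.\<close>
    also have "\<dots> = (\<integral>\<^sup>+\<omega>. emeasure (\<nu> (Z \<omega>)) (Pi\<^sub>E I A) \<partial>M)"
    proof (rule nn_integral_cong)
      fix \<omega> assume "\<omega> \<in> space M"
      then have z: "Z \<omega> \<in> space N" by (rule measurable_space[OF Z])
      interpret \<kappa>: prob_space "\<kappa> (Z \<omega>)" by (rule \<kappa>z(1)[OF z])
      have comp: "(\<lambda>x. x j) \<in> \<kappa> (Z \<omega>) \<rightarrow>\<^sub>M borel" for j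
        using measurable_component_PiM_borel by (simp add: \<kappa>z(2)[OF z] cong: measurable_cong_sets)
      interpret P: product_prob_space "\<lambda>j. distr (\<kappa> (Z \<omega>)) borel (\<lambda>x. x j)" I
        by (intro product_prob_spaceI \<kappa>.prob_space_distr comp)
      have "emeasure (\<nu> (Z \<omega>)) (Pi\<^sub>E I A) = (\<Prod>j\<in>I. emeasure (distr (\<kappa> (Z \<omega>)) borel (\<lambda>x. x j)) (A j))"
        unfolding \<nu>_def using I A by (intro P.emeasure_PiM) auto
      also have "\<dots> = (\<Prod>j\<in>I. emeasure (\<kappa> (Z \<omega>)) (C j))"
        using A sets_eq_imp_space_eq[OF \<kappa>z(2)[OF z]]
        by (intro prod.cong refl) (simp add: emeasure_distr[OF comp] C_def)
      finally show "ennreal (\<Prod>j\<in>I. measure (\<kappa> (Z \<omega>)) (C j)) = emeasure (\<nu> (Z \<omega>)) (Pi\<^sub>E I A)"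
        by (simp add: \<kappa>.emeasure_eq_measure prod_ennreal)
    qed
    also have "\<dots> = (\<integral>\<^sup>+z. emeasure (\<nu> z) (Pi\<^sub>E I A) \<partial>distr M N Z)"
      using measurable_emeasure_kernel[OF measurable_prob_algebraD[OF \<nu>] box]
      by (intro nn_integral_distr[symmetric] Z) simp
    also have "\<dots> = emeasure (distr M N Z \<bind> \<nu>) (Pi\<^sub>E I A)"
      by (rule emeasure_bind_prob_algebra[OF D \<nu> box, symmetric])
    finally show "emeasure ?D (Pi\<^sub>E I A) = emeasure (distr M N Z \<bind> \<nu>) (Pi\<^sub>E I A)" .
  qed
  then show ?thesis by (simp add: \<nu>_def[abs_def])
qed

text \<open>Integrate against the joint law written as a mixture of products; for each fixed
  \<open>z\<close>, Tonelli splits the integral over the product measure. Values in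
  \<open>ennreal\<close> avoid any integrability question.\<close>

lemma nn_integral_prod_cond_indep:
  fixes X :: "'i \<Rightarrow> 'a \<Rightarrow> 'b :: topological_space" and f :: "'i \<Rightarrow> 'b \<Rightarrow> ennreal"
  assumes M: "prob_space M" and Z: "Z \<in> M \<rightarrow>\<^sub>M N" and I: "finite I"
    and X: "\<And>j. j \<in> I \<Longrightarrow> X j \<in> borel_measurable M"
    and indep: "cond_indep_vars M (rv_algebra M N Z) (\<lambda>_. borel) X I"
    and rcd: "regular_cond_distr M N Z (\<Pi>\<^sub>M j\<in>I. borel) (\<lambda>\<omega>. \<lambda>j\<in>I. X j \<omega>) \<kappa>"
    and f: "\<And>j. j \<in> I \<Longrightarrow> f j \<in> borel_measurable borel"
  shows "(\<integral>\<^sup>+\<omega>. (\<Prod>j\<in>I. f j (X j \<omega>)) \<partial>M)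
    = (\<integral>\<^sup>+z. (\<Prod>j\<in>I. \<integral>\<^sup>+x. f j (x j) \<partial>\<kappa> z) \<partial>distr M N Z)"
proof -
  let ?K = "\<Pi>\<^sub>M j\<in>I. (borel :: 'b measure)"
  let ?\<nu> = "\<lambda>z. \<Pi>\<^sub>M j\<in>I. distr (\<kappa> z) borel (\<lambda>x. x j)"
  have \<kappa>: "\<kappa> \<in> N \<rightarrow>\<^sub>M prob_algebra ?K"
    using rcd by (simp add: regular_cond_distr_def)
  have marg: "(\<lambda>z. distr (\<kappa> z) borel (\<lambda>x. x j)) \<in> N \<rightarrow>\<^sub>M prob_algebra borel" for j
    by (rule measurable_compose[OF \<kappa> measurable_distr_prob_space[OF measurable_component_PiM_borel]])
  have \<nu>: "?\<nu> \<in> N \<rightarrow>\<^sub>M prob_algebra ?K"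
    by (rule measurable_prob_algebra_PiM[OF I marg])
  have Y: "(\<lambda>\<omega>. \<lambda>j\<in>I. X j \<omega>) \<in> M \<rightarrow>\<^sub>M ?K"
    by (rule measurable_restrict) (rule X)
  have g: "(\<lambda>x. \<Prod>j\<in>I. f j (x j)) \<in> borel_measurable ?K"
    by (intro borel_measurable_prod_ennreal measurable_compose[OF measurable_component_PiM_borel f])
  \<comment> \<open>Passing through the restricted vector exhibits the integrand as a function of
    the random vector whose law is known.\<close>
  have "(\<integral>\<^sup>+\<omega>. (\<Prod>j\<in>I. f j (X j \<omega>)) \<partial>M) = (\<integral>\<^sup>+\<omega>. (\<Prod>j\<in>I. f j ((\<lambda>j\<in>I. X j \<omega>) j)) \<partial>M)"
    by (intro nn_integral_cong prod.cong) auto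
  also have "\<dots> = (\<integral>\<^sup>+x. (\<Prod>j\<in>I. f j (x j)) \<partial>distr M ?K (\<lambda>\<omega>. \<lambda>j\<in>I. X j \<omega>))"
    by (rule nn_integral_distr[OF Y, symmetric]) (use g in simp)
  also have "\<dots> = (\<integral>\<^sup>+x. (\<Prod>j\<in>I. f j (x j)) \<partial>(distr M N Z \<bind> ?\<nu>))"
    by (simp only: distr_eq_bind_PiM_marginals[OF M Z I X indep rcd])
  also have "\<dots> = (\<integral>\<^sup>+z. \<integral>\<^sup>+x. (\<Prod>j\<in>I. f j (x j)) \<partial>?\<nu> z \<partial>distr M N Z)"
    using measurable_prob_algebraD[OF \<nu>] by (intro nn_integral_bind[OF g]) simp
  also have "\<dots> = (\<integral>\<^sup>+z. (\<Prod>j\<in>I. \<integral>\<^sup>+x. f j (x j) \<partial>\<kappa> z) \<partial>distr M N Z)"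
  proof (rule nn_integral_cong)
    fix z assume "z \<in> space (distr M N Z)"
    then have "z \<in> space N" by simp
    then have \<kappa>z: "prob_space (\<kappa> z)" "sets (\<kappa> z) = sets ?K"
      using measurable_space[OF \<kappa>] by (auto simp: space_prob_algebra)
    interpret \<kappa>: prob_space "\<kappa> z" by (rule \<kappa>z)
    have comp: "(\<lambda>x. x j) \<in> \<kappa> z \<rightarrow>\<^sub>M borel" for j
      using measurable_component_PiM_borel by (simp add: \<kappa>z(2) cong: measurable_cong_sets)
    interpret P: product_prob_space "\<lambda>j. distr (\<kappa> z) borel (\<lambda>x. x j)" I
      by (intro product_prob_spaceI \<kappa>.prob_space_distr comp)
    have f': "f j \<in> borel_measurable (distr (\<kappa> z) borel (\<lambda>x. x j))" if "j \<in> I" for j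
      using f[OF that] by simp
    have "(\<integral>\<^sup>+x. (\<Prod>j\<in>I. f j (x j)) \<partial>?\<nu> z)
        = (\<Prod>j\<in>I. integral\<^sup>N (distr (\<kappa> z) borel (\<lambda>x. x j)) (f j))"
      by (rule P.product_nn_integral_prod[OF I f'])
    also have "\<dots> = (\<Prod>j\<in>I. \<integral>\<^sup>+x. f j (x j) \<partial>\<kappa> z)"
      by (intro prod.cong refl nn_integral_distr comp f')
    finally show "(\<integral>\<^sup>+x. (\<Prod>j\<in>I. f j (x j)) \<partial>?\<nu> z) = (\<Prod>j\<in>I. \<integral>\<^sup>+x. f j (x j) \<partial>\<kappa> z)" .
  qed
  finally show ?thesis .
qed

section \<open>Almost sure properties under the conditional distribution\<close>

text \<open>The indicator of an almost sure event has conditional expectation 1, so the kernel gives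
  the event mass 1 at almost every \<open>z\<close>. It will carry nonnegativity of the
  \<open>X j\<close> over to the coordinates under \<open>\<kappa> \<theta>\<close>.\<close>

lemma AE_regular_cond_distr:
  assumes M: "prob_space M" and Z: "Z \<in> M \<rightarrow>\<^sub>M N" and Y: "Y \<in> M \<rightarrow>\<^sub>M K"
    and rcd: "regular_cond_distr M N Z K Y \<kappa>"
    and P: "Measurable.pred K P" and ae: "AE \<omega> in M. P (Y \<omega>)"
  shows "AE z in distr M N Z. AE y in \<kappa> z. P y"
proof -
  interpret prob_space M by (rule M)
  interpret F: finite_measure_subalgebra M "rv_algebra M N Z"
    by standard (rule subalgebra_rv_algebra[OF Z])
  have \<kappa>: "\<kappa> \<in> N \<rightarrow>\<^sub>M prob_algebra K"
    using rcd by (simp add: regular_cond_distr_def)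
  let ?A = "{y \<in> space K. P y}"
  have A: "?A \<in> sets K" using P by simp
  have "AE \<omega> in M. real_cond_exp M (rv_algebra M N Z) (\<lambda>\<omega>. indicator ?A (Y \<omega>)) \<omega>
      = real_cond_exp M (rv_algebra M N Z) (\<lambda>_. 1) \<omega>"
  proof (rule F.real_cond_exp_cong)
    show "AE \<omega> in M. indicator ?A (Y \<omega>) = (1 :: real)"
      using ae AE_space by eventually_elim (use measurable_space[OF Y] in auto)
  qed (use A Y in auto)
  moreover have "AE \<omega> in M. real_cond_exp M (rv_algebra M N Z) (\<lambda>_. 1) \<omega> = 1"
    by (rule F.real_cond_exp_F_meas) auto
  moreover have "AE \<omega> in M. measure (\<kappa> (Z \<omega>)) ?A
      = real_cond_exp M (rv_algebra M N Z) (\<lambda>\<omega>. indicator ?A (Y \<omega>)) \<omega>"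
    using rcd A by (simp add: regular_cond_distr_def)
  ultimately have "AE \<omega> in M. measure (\<kappa> (Z \<omega>)) ?A = 1"
    by eventually_elim simp
  \<comment> \<open>Measurability in \<open>z\<close> allows the almost sure statement to pass from
    \<open>M\<close> to the law of \<open>Z\<close>.\<close>
  moreover have "Measurable.pred N (\<lambda>z. measure (\<kappa> z) ?A = 1)"
    using measurable_compose[OF \<kappa> measurable_measure_prob_algebra[OF A]] by measurable
  ultimately have "AE z in distr M N Z. measure (\<kappa> z) ?A = 1"
    by (subst AE_distr_iff[OF Z]) auto
  then show ?thesis
    using AE_space
  proof eventually_elim
    case (elim z)
    then have \<kappa>z: "prob_space (\<kappa> z)" "sets (\<kappa> z) = sets K"
      using measurable_space[OF \<kappa>] by (auto simp: space_prob_algebra)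
    interpret \<kappa>: prob_space "\<kappa> z" by (rule \<kappa>z)
    have "AE y in \<kappa> z. y \<in> ?A"
      using elim A by (intro \<kappa>.AE_prob_1)
    then show ?case by auto
  qed
qed

section \<open>The Laplace transform of the sum\<close>

text \<open>From \<open>1 + u \<le> exp u\<close> at \<open>u = t * x\<close>. The bound makes the
  factor with the extra \<open>x\<close> integrable under a probability measure with no moment
  assumption on \<open>X i\<close>.\<close>

lemma mult_exp_neg_le:
  fixes x t :: real
  assumes "0 < t"
  shows "x * exp (- t * x) \<le> 1 / t"
proof -
  have "t * x \<le> exp (t * x)"
    using exp_ge_add_one_self[of "t * x"] by linarith
  then have "t * x * exp (- (t * x)) \<le> exp (t * x) * exp (- (t * x))"
    by (rule mult_right_mono) simp
  then show ?thesis
    using assms by (simp add: exp_minus field_simps)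
qed

theorem proposition1:
  fixes M :: "'a measure" and \<Theta> :: "'a \<Rightarrow> real" and X :: "nat \<Rightarrow> 'a \<Rightarrow> real"
    and n :: nat and \<kappa> :: "real \<Rightarrow> (nat \<Rightarrow> real) measure"
  assumes "prob_space M"
    and "\<Theta> \<in> borel_measurable M" and "AE \<omega> in M. 0 \<le> \<Theta> \<omega>"
    and "\<And>j. j \<in> {1..n} \<Longrightarrow> X j \<in> borel_measurable M"
    and "\<And>j. j \<in> {1..n} \<Longrightarrow> AE \<omega> in M. 0 \<le> X j \<omega>"
    and "cond_indep_vars M (rv_algebra M borel \<Theta>) (\<lambda>_. borel) X {1..n}"
    and "regular_cond_distr M borel \<Theta> (\<Pi>\<^sub>M j\<in>{1..n}. borel) (\<lambda>\<omega>. \<lambda>j\<in>{1..n}. X j \<omega>) \<kappa>"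
    and "\<And>j. j \<in> {1..n} \<Longrightarrow>
           (\<lambda>(\<theta>, t). \<integral>x. exp (- t * x j) \<partial>\<kappa> \<theta>)
             \<in> borel_measurable (restrict_space borel {0..} \<Otimes>\<^sub>M restrict_space borel {0<..})"
  shows "\<forall>t>0. \<forall>i\<in>{1..n}.
    (\<integral>\<omega>. X i \<omega> * exp (- t * (\<Sum>j\<in>{1..n}. X j \<omega>)) \<partial>M)
    = (\<integral>\<theta>\<in>{0..}. ((\<integral>x. x i * exp (- t * x i) \<partial>\<kappa> \<theta>)
          * (\<Prod>j\<in>{1..n} - {i}. (\<integral>x. exp (- t * x j) \<partial>\<kappa> \<theta>))) \<partial>(distr M borel \<Theta>))"
proof (intro allI impI ballI)
  fix t :: real and i assume t: "0 < t" and i: "i \<in> {1..n}"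
  let ?I = "{1..n}" and ?K = "\<Pi>\<^sub>M j\<in>{1..n}. (borel :: real measure)"
  \<comment> \<open>Absorbing the factor \<open>x\<close> into index \<open>i\<close> turns the
    integrand into a product over all of \<open>{1..n}\<close>, the form treated by
    \<open>nn_integral_prod_cond_indep\<close>.\<close>
  define f where "f j x = (if j = i then x * exp (- t * x) else exp (- t * x))" for j and x :: real
  have f[measurable]: "f j \<in> borel_measurable borel" for j
    unfolding f_def[abs_def] by measurable
  have f_nonneg: "0 \<le> f j x" and f_le: "f j x \<le> max 1 (1 / t)" if "0 \<le> x" for j x
    using that t mult_exp_neg_le[OF t, of x] by (auto simp: f_def le_max_iff_disj)
  \<comment> \<open>The functional \<open>g\<close> is arbitrary so that the same splitting serves
    twice: for evaluation at \<open>X j \<omega>\<close> and for integration against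
    \<open>\<kappa> \<theta>\<close>.\<close>
  have prod_f: "(\<Prod>j\<in>?I. g (f j) j) = g (\<lambda>x. x * exp (- t * x)) i * (\<Prod>j\<in>?I - {i}. g (\<lambda>x. exp (- t * x)) j)"
    for g :: "(real \<Rightarrow> real) \<Rightarrow> nat \<Rightarrow> real"
  proof -
    have "(\<Prod>j\<in>?I. g (f j) j) = g (f i) i * (\<Prod>j\<in>?I - {i}. g (f j) j)"
      using i by (intro prod.remove) auto
    also have "(\<Prod>j\<in>?I - {i}. g (f j) j) = (\<Prod>j\<in>?I - {i}. g (\<lambda>x. exp (- t * x)) j)"
      by (intro prod.cong) (auto simp: f_def[abs_def])
    also have "f i = (\<lambda>x. x * exp (- t * x))"
      by (simp add: f_def[abs_def])
    finally show ?thesis .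
  qed
  have \<kappa>: "\<kappa> \<in> borel \<rightarrow>\<^sub>M prob_algebra ?K"
    using assms(7) by (simp add: regular_cond_distr_def)
  have Y: "(\<lambda>\<omega>. \<lambda>j\<in>?I. X j \<omega>) \<in> M \<rightarrow>\<^sub>M ?K"
    by (rule measurable_restrict) (rule assms(4))
  have X_nonneg: "AE \<omega> in M. \<forall>j\<in>?I. 0 \<le> X j \<omega>"
    using assms(5) by (simp add: AE_finite_all)
  have \<kappa>_nonneg: "AE \<theta> in distr M borel \<Theta>. AE x in \<kappa> \<theta>. \<forall>j\<in>?I. 0 \<le> x j"
    using X_nonneg by (intro AE_regular_cond_distr[OF assms(1,2) Y assms(7)]) auto
  define h where "h \<theta> = (\<Prod>j\<in>?I. \<integral>x. f j (x j) \<partial>\<kappa> \<theta>)" for \<theta>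
  have int_meas: "(\<lambda>\<theta>. \<integral>x. f j (x j) \<partial>\<kappa> \<theta>) \<in> borel_measurable borel" for j
    by (intro measurable_compose[OF measurable_prob_algebraD[OF \<kappa>] integral_measurable_subprob_algebra]
        measurable_compose[OF measurable_component_PiM_borel f])
  have h: "h \<in> borel_measurable borel"
    unfolding h_def[abs_def] by (intro borel_measurable_prod int_meas)
  \<comment> \<open>The Bochner and extended integrals are matched only for those \<theta> at which
    \<open>\<kappa> \<theta>\<close> is carried by nonnegative vectors; elsewhere the bounds on
    \<open>f\<close> may fail.\<close>
  have h_nn: "AE \<theta> in distr M borel \<Theta>. 0 \<le> h \<theta> \<and>
      (\<Prod>j\<in>?I. \<integral>\<^sup>+x. ennreal (f j (x j)) \<partial>\<kappa> \<theta>) = ennreal (h \<theta>)"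
    using \<kappa>_nonneg
  proof eventually_elim
    case (elim \<theta>)
    have \<kappa>z: "prob_space (\<kappa> \<theta>)" "sets (\<kappa> \<theta>) = sets ?K"
      using measurable_space[OF \<kappa>, of \<theta>] by (auto simp: space_prob_algebra)
    interpret \<kappa>: prob_space "\<kappa> \<theta>" by (rule \<kappa>z)
    have meas: "(\<lambda>x. f j (x j)) \<in> borel_measurable (\<kappa> \<theta>)" for j
      using measurable_compose[OF measurable_component_PiM_borel f]
      by (simp add: \<kappa>z(2) cong: measurable_cong_sets)
    have nonneg: "AE x in \<kappa> \<theta>. 0 \<le> f j (x j)" if "j \<in> ?I" for j
      using elim by eventually_elim (use that f_nonneg in auto)
    \<comment> \<open>The constant covers both kinds of factor: 1 for the plain exponentials,
      \<open>1 / t\<close> for index \<open>i\<close>.\<close>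
    have int: "integrable (\<kappa> \<theta>) (\<lambda>x. f j (x j))" if "j \<in> ?I" for j
    proof (rule \<kappa>.integrable_const_bound[OF _ meas])
      show "AE x in \<kappa> \<theta>. norm (f j (x j)) \<le> max 1 (1 / t)"
        using elim by eventually_elim (use that f_nonneg f_le in auto)
    qed
    have nonneg_int: "0 \<le> (\<integral>x. f j (x j) \<partial>\<kappa> \<theta>)" if "j \<in> ?I" for j
      using nonneg[OF that] by (rule integral_nonneg_AE)
    have "(\<Prod>j\<in>?I. \<integral>\<^sup>+x. ennreal (f j (x j)) \<partial>\<kappa> \<theta>) = (\<Prod>j\<in>?I. ennreal (\<integral>x. f j (x j) \<partial>\<kappa> \<theta>))"
      by (intro prod.cong refl nn_integral_eq_integral int nonneg)
    also have "\<dots> = ennreal (h \<theta>)"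
      unfolding h_def by (rule prod_ennreal) (rule nonneg_int)
    finally show ?case
      using nonneg_int by (auto simp: h_def intro: prod_nonneg)
  qed
  have "(\<integral>\<omega>. X i \<omega> * exp (- t * (\<Sum>j\<in>?I. X j \<omega>)) \<partial>M) = (\<integral>\<omega>. (\<Prod>j\<in>?I. f j (X j \<omega>)) \<partial>M)"
  proof (rule arg_cong[where f = "integral\<^sup>L M"], rule ext)
    fix \<omega>
    have "exp (- t * (\<Sum>j\<in>?I. X j \<omega>)) = (\<Prod>j\<in>?I. exp (- t * X j \<omega>))"
      by (simp add: sum_distrib_left exp_sum sum_negf[symmetric] del: sum_negf)
    then show "X i \<omega> * exp (- t * (\<Sum>j\<in>?I. X j \<omega>)) = (\<Prod>j\<in>?I. f j (X j \<omega>))"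
      using i prod.remove[of ?I i "\<lambda>j. exp (- t * X j \<omega>)"]
      by (simp only: prod_f[of "\<lambda>g j. g (X j \<omega>)"] finite_atLeastAtMost mult.assoc)
  qed
  \<comment> \<open>The conversion asks only for measurability and almost sure nonnegativity:
    \<open>enn2real\<close> sends infinity to 0, which is also the default value of the Bochner
    integral.\<close>
  also have "\<dots> = enn2real (\<integral>\<^sup>+\<omega>. ennreal (\<Prod>j\<in>?I. f j (X j \<omega>)) \<partial>M)"
  proof (rule integral_eq_nn_integral)
    show "(\<lambda>\<omega>. \<Prod>j\<in>?I. f j (X j \<omega>)) \<in> borel_measurable M"
      by (intro borel_measurable_prod measurable_compose[OF assms(4) f])
    show "AE \<omega> in M. 0 \<le> (\<Prod>j\<in>?I. f j (X j \<omega>))"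
      using X_nonneg by eventually_elim (auto intro!: prod_nonneg f_nonneg)
  qed
  also have "(\<integral>\<^sup>+\<omega>. ennreal (\<Prod>j\<in>?I. f j (X j \<omega>)) \<partial>M) = (\<integral>\<^sup>+\<omega>. (\<Prod>j\<in>?I. ennreal (f j (X j \<omega>))) \<partial>M)"
    using X_nonneg by (intro nn_integral_cong_AE, eventually_elim)
      (auto intro!: prod_ennreal[symmetric] f_nonneg)
  also have "\<dots> = (\<integral>\<^sup>+\<theta>. (\<Prod>j\<in>?I. \<integral>\<^sup>+x. ennreal (f j (x j)) \<partial>\<kappa> \<theta>) \<partial>distr M borel \<Theta>)"
    by (rule nn_integral_prod_cond_indep[OF assms(1,2) _ assms(4,6,7)]) auto
  also have "\<dots> = (\<integral>\<^sup>+\<theta>. ennreal (h \<theta>) \<partial>distr M borel \<Theta>)"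
    using h_nn by (intro nn_integral_cong_AE, eventually_elim) simp
  also have "enn2real \<dots> = (\<integral>\<theta>. h \<theta> \<partial>distr M borel \<Theta>)"
    using h h_nn by (intro integral_eq_nn_integral[symmetric]) auto
  \<comment> \<open>The law of \<open>\<Theta>\<close> is carried by the nonnegative half-line, so
    the restriction changes the integrand on a null set only.\<close>
  also have "\<dots> = (\<integral>\<theta>\<in>{0..}. h \<theta> \<partial>distr M borel \<Theta>)"
    unfolding set_lebesgue_integral_def
  proof (rule integral_cong_AE)
    have "AE \<theta> in distr M borel \<Theta>. 0 \<le> \<theta>"
      using assms(3) by (subst AE_distr_iff[OF assms(2)]) auto
    then show "AE \<theta> in distr M borel \<Theta>. h \<theta> = indicat_real {0..} \<theta> *\<^sub>R h \<theta>"
      by eventually_elim simp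
  qed (use h in auto)
  also have "\<dots> = (\<integral>\<theta>\<in>{0..}. ((\<integral>x. x i * exp (- t * x i) \<partial>\<kappa> \<theta>)
          * (\<Prod>j\<in>?I - {i}. (\<integral>x. exp (- t * x j) \<partial>\<kappa> \<theta>))) \<partial>(distr M borel \<Theta>))"
    unfolding h_def by (simp only: prod_f[of "\<lambda>g j. \<integral>x. g (x j) \<partial>\<kappa> _"])
  finally show "(\<integral>\<omega>. X i \<omega> * exp (- t * (\<Sum>j\<in>?I. X j \<omega>)) \<partial>M)
    = (\<integral>\<theta>\<in>{0..}. ((\<integral>x. x i * exp (- t * x i) \<partial>\<kappa> \<theta>)
          * (\<Prod>j\<in>?I - {i}. (\<integral>x. exp (- t * x j) \<partial>\<kappa> \<theta>))) \<partial>(distr M borel \<Theta>))" .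
qed

end
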